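(* Let $S^0$ be an inverse semigroup with semilattice of idempotents $E^0$. Let $L$ be a left inverse semigroup and $R$ a right inverse semigroup and suppose that $S^0$ is a common quasi-ideal inverse transversal of $L$ and $R$; for $x$ in $L$ or $R$ let $x^0$ denote the unique inverse of $x$ lying in $S^0$. Let $R\times L\to S^0$ be a map denoted by $(a,x)\mapsto a\ast x$ and suppose that $\ast$ satisfies (1) for all $y,z\in L$, $a,b\in R$ with $y^0=b^0$, $(a\ast y)(b^0b)\ast z = a\ast (yy^0)(b\ast z)$; (2) if $a\in S^0$ or $x\in S^0$ then $a\ast x = ax$; (3) for all $e\in E(R)$, $f \in E(L)$, $e\ast f \in E^0$. Let $T = \{(x,a)\in L\times R : x^0 = a^0\}$ and define $(x,a)(y,b)=((xx^0)(a\ast y),(a\ast y)(b^0b))$. Then $T$ is a regular semigroup with a multiplicative inverse transversal $T^0$ with $T^0\cong S^0$. Moreover every regular semigroup with a multiplicative inverse transversal can be constructed (up to isomorphism) in this way.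
   Context: An inverse subsemigroup $S^0$ of a regular semigroup $S$ is an inverse transversal if each $x\in S$ has exactly one inverse $x^0$ in $S^0$; it is a quasi-ideal if $S^0SS^0\subseteq S^0$, and multiplicative if $\Lambda I\subseteq E^0$ where $I=\{xx^0:x\in S\}$ and $\Lambda=\{x^0x:x\in S\}$. A left (right) inverse semigroup is a regular semigroup whose idempotents form a left (right) regular band. *)

theory Defs
  imports Main
begin

definition semigrp :: "'a set \<Rightarrow> ('a \<Rightarrow> 'a \<Rightarrow> 'a) \<Rightarrow> bool" where
  "semigrp S m \<longleftrightarrow> (\<forall>x\<in>S. \<forall>y\<in>S. m x y \<in> S) \<and>
     (\<forall>x\<in>S. \<forall>y\<in>S. \<forall>z\<in>S. m (m x y) z = m x (m y z))"

definition idems :: "'a set \<Rightarrow> ('a \<Rightarrow> 'a \<Rightarrow> 'a) \<Rightarrow> 'a set" where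
  "idems S m = {e \<in> S. m e e = e}"

definition is_inv :: "('a \<Rightarrow> 'a \<Rightarrow> 'a) \<Rightarrow> 'a \<Rightarrow> 'a \<Rightarrow> bool" where
  "is_inv m x y \<longleftrightarrow> m (m x y) x = x \<and> m (m y x) y = y"

definition regular_semigrp :: "'a set \<Rightarrow> ('a \<Rightarrow> 'a \<Rightarrow> 'a) \<Rightarrow> bool" where
  "regular_semigrp S m \<longleftrightarrow> semigrp S m \<and> (\<forall>x\<in>S. \<exists>y\<in>S. m (m x y) x = x)"

definition inverse_semigrp :: "'a set \<Rightarrow> ('a \<Rightarrow> 'a \<Rightarrow> 'a) \<Rightarrow> bool" where
  "inverse_semigrp S m \<longleftrightarrow> semigrp S m \<and> (\<forall>x\<in>S. \<exists>!y. y \<in> S \<and> is_inv m x y)"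

definition left_inverse_semigrp :: "'a set \<Rightarrow> ('a \<Rightarrow> 'a \<Rightarrow> 'a) \<Rightarrow> bool" where
  "left_inverse_semigrp S m \<longleftrightarrow> regular_semigrp S m \<and>
     (\<forall>e\<in>idems S m. \<forall>f\<in>idems S m. m e f \<in> idems S m \<and> m (m e f) e = m e f)"

definition right_inverse_semigrp :: "'a set \<Rightarrow> ('a \<Rightarrow> 'a \<Rightarrow> 'a) \<Rightarrow> bool" where
  "right_inverse_semigrp S m \<longleftrightarrow> regular_semigrp S m \<and>
     (\<forall>e\<in>idems S m. \<forall>f\<in>idems S m. m e f \<in> idems S m \<and> m (m e f) e = m f e)"

definition inverse_transversal :: "'a set \<Rightarrow> ('a \<Rightarrow> 'a \<Rightarrow> 'a) \<Rightarrow> 'a set \<Rightarrow> bool" where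
  "inverse_transversal S m S0 \<longleftrightarrow> S0 \<subseteq> S \<and> inverse_semigrp S0 m \<and>
     (\<forall>x\<in>S. \<exists>!y. y \<in> S0 \<and> is_inv m x y)"

definition tinv :: "('a \<Rightarrow> 'a \<Rightarrow> 'a) \<Rightarrow> 'a set \<Rightarrow> 'a \<Rightarrow> 'a" where
  "tinv m S0 x = (THE y. y \<in> S0 \<and> is_inv m x y)"

definition quasi_ideal :: "'a set \<Rightarrow> ('a \<Rightarrow> 'a \<Rightarrow> 'a) \<Rightarrow> 'a set \<Rightarrow> bool" where
  "quasi_ideal S m S0 \<longleftrightarrow> (\<forall>s\<in>S0. \<forall>x\<in>S. \<forall>t\<in>S0. m (m s x) t \<in> S0)"

text \<open>Multiplicative: Lambda I is contained in E^0, with I = {x x^0}, Lambda = {x^0 x}.\<close>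
definition multiplicative :: "'a set \<Rightarrow> ('a \<Rightarrow> 'a \<Rightarrow> 'a) \<Rightarrow> 'a set \<Rightarrow> bool" where
  "multiplicative S m S0 \<longleftrightarrow>
     (\<forall>x\<in>S. \<forall>y\<in>S. m (m (tinv m S0 x) x) (m y (tinv m S0 y)) \<in> idems S0 m)"

definition semigrp_iso :: "'a set \<Rightarrow> ('a \<Rightarrow> 'a \<Rightarrow> 'a) \<Rightarrow> 'b set \<Rightarrow> ('b \<Rightarrow> 'b \<Rightarrow> 'b) \<Rightarrow> ('a \<Rightarrow> 'b) \<Rightarrow> bool" where
  "semigrp_iso A mA B mB f \<longleftrightarrow> bij_betw f A B \<and> (\<forall>x\<in>A. \<forall>y\<in>A. f (mA x y) = mB (f x) (f y))"

definition semigrp_isomorphic :: "'a set \<Rightarrow> ('a \<Rightarrow> 'a \<Rightarrow> 'a) \<Rightarrow> 'b set \<Rightarrow> ('b \<Rightarrow> 'b \<Rightarrow> 'b) \<Rightarrow> bool" where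
  "semigrp_isomorphic A mA B mB \<longleftrightarrow> (\<exists>f. semigrp_iso A mA B mB f)"

text \<open>The data of the construction: S0 an inverse semigroup, L (with product mL) a left
  inverse semigroup, R (with product mR) a right inverse semigroup, S0 a common quasi-ideal
  inverse transversal of L and R (the products of L and R agree on S0), and a map
  star : R x L -> S0 satisfying (1)-(3).\<close>
definition construction_data ::
  "'a set \<Rightarrow> 'a set \<Rightarrow> ('a \<Rightarrow> 'a \<Rightarrow> 'a) \<Rightarrow> 'a set \<Rightarrow> ('a \<Rightarrow> 'a \<Rightarrow> 'a) \<Rightarrow> ('a \<Rightarrow> 'a \<Rightarrow> 'a) \<Rightarrow> bool" where
  "construction_data S0 L mL R mR star \<longleftrightarrow>
     inverse_semigrp S0 mL \<and>
     left_inverse_semigrp L mL \<and> right_inverse_semigrp R mR \<and>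
     (\<forall>s\<in>S0. \<forall>t\<in>S0. mL s t = mR s t) \<and>
     inverse_transversal L mL S0 \<and> quasi_ideal L mL S0 \<and>
     inverse_transversal R mR S0 \<and> quasi_ideal R mR S0 \<and>
     (\<forall>a\<in>R. \<forall>x\<in>L. star a x \<in> S0) \<and>
     (\<forall>y\<in>L. \<forall>z\<in>L. \<forall>a\<in>R. \<forall>b\<in>R. tinv mL S0 y = tinv mR S0 b \<longrightarrow>
        star (mR (star a y) (mR (tinv mR S0 b) b)) z
          = star a (mL (mL y (tinv mL S0 y)) (star b z))) \<and>
     (\<forall>a\<in>R. \<forall>x\<in>L. a \<in> S0 \<longrightarrow> star a x = mL a x) \<and>
     (\<forall>a\<in>R. \<forall>x\<in>L. x \<in> S0 \<longrightarrow> star a x = mR a x) \<and>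
     (\<forall>e\<in>idems R mR. \<forall>f\<in>idems L mL. star e f \<in> idems S0 mL)"

definition Tset :: "'a set \<Rightarrow> 'a set \<Rightarrow> ('a \<Rightarrow> 'a \<Rightarrow> 'a) \<Rightarrow> 'a set \<Rightarrow> ('a \<Rightarrow> 'a \<Rightarrow> 'a) \<Rightarrow> ('a \<times> 'a) set" where
  "Tset S0 L mL R mR = {(x, a). x \<in> L \<and> a \<in> R \<and> tinv mL S0 x = tinv mR S0 a}"

definition Tmult :: "'a set \<Rightarrow> ('a \<Rightarrow> 'a \<Rightarrow> 'a) \<Rightarrow> ('a \<Rightarrow> 'a \<Rightarrow> 'a) \<Rightarrow> ('a \<Rightarrow> 'a \<Rightarrow> 'a)
     \<Rightarrow> 'a \<times> 'a \<Rightarrow> 'a \<times> 'a \<Rightarrow> 'a \<times> 'a" where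
  "Tmult S0 mL mR star p q =
     (case p of (x, a) \<Rightarrow> case q of (y, b) \<Rightarrow>
        (mL (mL x (tinv mL S0 x)) (star a y), mR (star a y) (mR (tinv mR S0 b) b)))"

end

theory Submission
  imports Defs
begin

text \<open>
  For the construction, associativity of the product on \<open>T\<close> comes from axiom (1) together with
  the identities \<open>x\<^sup>0x = x\<^sup>0x\<^sup>0\<^sup>0\<close> in the left inverse semigroup \<open>L\<close> and \<open>aa\<^sup>0 = a\<^sup>0\<^sup>0a\<^sup>0\<close> in the
  right inverse semigroup \<open>R\<close>; one checks that \<open>(x\<^sup>0, x\<^sup>0)\<close> is the only inverse of \<open>(x, a)\<close> in
  the diagonal \<open>T\<^sup>0 = {(s, s) | s \<in> S\<^sup>0}\<close>, which is a copy of \<open>S\<^sup>0\<close>, and axiom (3) makes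
  \<open>T\<^sup>0\<close> multiplicative.

  Conversely, if \<open>S\<^sup>0\<close> is a multiplicative inverse transversal of \<open>S\<close>, then
  \<open>(xy)\<^sup>0 = y\<^sup>0(x\<^sup>0xyy\<^sup>0)x\<^sup>0\<close> with \<open>x\<^sup>0xyy\<^sup>0 \<in> E\<^sup>0\<close>. From this one shows that
  \<open>L = {x. x\<^sup>0x = x\<^sup>0x\<^sup>0\<^sup>0}\<close> is a left inverse subsemigroup and, dually,
  \<open>R = {a. aa\<^sup>0 = a\<^sup>0\<^sup>0a\<^sup>0}\<close> a right inverse subsemigroup, both having \<open>S\<^sup>0\<close> as a quasi-ideal
  inverse transversal. Taking \<open>\<ast>\<close> to be the product of \<open>S\<close>, the map \<open>(x, a) \<mapsto> xx\<^sup>0a\<close> is an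
  isomorphism from \<open>T\<close> onto \<open>S\<close>, with inverse \<open>z \<mapsto> (zz\<^sup>0z\<^sup>0\<^sup>0, z\<^sup>0\<^sup>0z\<^sup>0z)\<close>.
\<close>

section \<open>Semigroups with an inverse transversal\<close>

locale inv_transversal =
  fixes S :: "'a set" and m :: "'a \<Rightarrow> 'a \<Rightarrow> 'a" and S0 :: "'a set"
  assumes semigrp: "semigrp S m" and transversal: "inverse_transversal S m S0"
begin

abbreviation t where "t x \<equiv> tinv m S0 x"

lemma closed [simp]: "x \<in> S \<Longrightarrow> y \<in> S \<Longrightarrow> m x y \<in> S"
  using semigrp unfolding semigrp_def by blast

lemma assoc [simp]: "x \<in> S \<Longrightarrow> y \<in> S \<Longrightarrow> z \<in> S \<Longrightarrow> m (m x y) z = m x (m y z)"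
  using semigrp unfolding semigrp_def by blast

lemma S0_subset: "S0 \<subseteq> S"
  using transversal unfolding inverse_transversal_def by blast

lemma S0_memD [simp]: "s \<in> S0 \<Longrightarrow> s \<in> S"
  using S0_subset by blast

lemma S0_closed [simp]: "x \<in> S0 \<Longrightarrow> y \<in> S0 \<Longrightarrow> m x y \<in> S0"
  using transversal unfolding inverse_transversal_def inverse_semigrp_def semigrp_def by blast

lemma ex1_inverse_in_S0: "x \<in> S \<Longrightarrow> \<exists>!y. y \<in> S0 \<and> is_inv m x y"
  using transversal unfolding inverse_transversal_def by blast

lemma tinv_spec: "x \<in> S \<Longrightarrow> t x \<in> S0 \<and> is_inv m x (t x)"
  unfolding tinv_def by (rule theI'[OF ex1_inverse_in_S0])

lemma tinv_in_S0 [simp]: "x \<in> S \<Longrightarrow> t x \<in> S0"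
  using tinv_spec by blast

lemma mult_tinv_mult [simp]: "x \<in> S \<Longrightarrow> m x (m (t x) x) = x"
  using tinv_spec[of x] unfolding is_inv_def by simp

lemma tinv_mult_tinv [simp]: "x \<in> S \<Longrightarrow> m (t x) (m x (t x)) = t x"
  using tinv_spec[of x] unfolding is_inv_def by simp

lemma mult_tinv_mult_left [simp]: "x \<in> S \<Longrightarrow> z \<in> S \<Longrightarrow> m x (m (t x) (m x z)) = m x z"
  by (metis assoc closed mult_tinv_mult S0_memD tinv_in_S0)

lemma tinv_mult_tinv_left [simp]: "x \<in> S \<Longrightarrow> z \<in> S \<Longrightarrow> m (t x) (m x (m (t x) z)) = m (t x) z"
  by (metis assoc closed tinv_mult_tinv S0_memD tinv_in_S0)

lemma tinv_eqI:
  assumes "x \<in> S" "y \<in> S0" "m x (m y x) = x" "m y (m x y) = y"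
  shows "t x = y"
proof -
  have "is_inv m x y" using assms(3,4) unfolding is_inv_def by (simp add: assms(1,2))
  thus ?thesis using assms(1,2) ex1_inverse_in_S0[of x] tinv_spec[of x] by blast
qed

lemma tinv_tinv [simp]: "s \<in> S0 \<Longrightarrow> t (t s) = s"
  by (rule tinv_eqI) auto

lemma tinv_idem: "e \<in> S0 \<Longrightarrow> m e e = e \<Longrightarrow> t e = e"
  by (rule tinv_eqI) auto

lemma idem_mult_left: "e \<in> S \<Longrightarrow> m e e = e \<Longrightarrow> z \<in> S \<Longrightarrow> m e (m e z) = m e z"
  by (metis assoc)

text \<open>The idempotents of the inverse semigroup \<open>S\<^sup>0\<close> form a semilattice; the proof goes through
  \<open>(ef)\<^sup>0 = f(ef)\<^sup>0e\<close>, which is idempotent and self-inverse.\<close>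

lemma S0_idem_mult:
  assumes e: "e \<in> S0" "m e e = e" and f: "f \<in> S0" "m f f = f"
  shows "m (m e f) (m e f) = m e f"
proof -
  define a where "a = m e f"
  define b where "b = t a"
  have ab: "a \<in> S0" "b \<in> S0" unfolding a_def b_def using e f by auto
  have ee: "\<And>z. z \<in> S \<Longrightarrow> m e (m e z) = m e z" using e by (simp add: idem_mult_left)
  have ff: "\<And>z. z \<in> S \<Longrightarrow> m f (m f z) = m f z" using f by (simp add: idem_mult_left)
  have aba: "m a (m b a) = a" and bab: "m b (m a b) = b" using ab unfolding b_def by simp_all
  have babz: "m b (m e (m f (m b z))) = m b z" if "z \<in> S" for z
  proof -
    have "m (m b (m a b)) z = m b z" using bab by simp
    thus ?thesis using ab e f that unfolding a_def by simp
  qed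
  have abaz: "m e (m f (m b (m e (m f z)))) = m e (m f z)" if "z \<in> S" for z
  proof -
    have "m (m a (m b a)) z = m a z" using aba by simp
    thus ?thesis using ab e f that unfolding a_def by simp
  qed
  have "t a = m f (m b e)"
  proof (rule tinv_eqI)
    show "m a (m (m f (m b e)) a) = a"
      using aba ab e f unfolding a_def by (simp add: ee ff abaz)
    show "m (m f (m b e)) (m a (m f (m b e))) = m f (m b e)"
      using ab e f unfolding a_def by (simp add: ee ff babz)
  qed (use ab e f in auto)
  hence bfe: "m f (m b e) = b" unfolding b_def by simp
  have "m b b = m (m f (m b e)) (m f (m b e))" by (simp only: bfe)
  also have "\<dots> = m f (m b e)" using ab e f by (simp add: babz)
  finally have bb: "m b b = b" using bfe by simp
  have "a = b" using tinv_idem[OF ab(2) bb] ab unfolding b_def by simp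
  thus ?thesis using bb unfolding a_def by simp
qed

lemma S0_idems_commute:
  assumes e: "e \<in> S0" "m e e = e" and f: "f \<in> S0" "m f f = f"
  shows "m e f = m f e"
proof -
  have ef: "m (m e f) (m e f) = m e f" by (rule S0_idem_mult[OF e f])
  have fe: "m (m f e) (m f e) = m f e" by (rule S0_idem_mult[OF f e])
  have "m f e = t (m e f)"
  proof (rule sym, rule tinv_eqI)
    have "m (m e f) (m (m f e) (m e f)) = m (m e f) (m e f)" using e f by (simp add: idem_mult_left)
    thus "m (m e f) (m (m f e) (m e f)) = m e f" using ef by simp
    have "m (m f e) (m (m e f) (m f e)) = m (m f e) (m f e)" using e f by (simp add: idem_mult_left)
    thus "m (m f e) (m (m e f) (m f e)) = m f e" using fe by simp
  qed (use e f in auto)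
  also have "\<dots> = m e f" by (rule tinv_idem) (use e f ef in auto)
  finally show ?thesis by simp
qed

lemma tinv_mult_S0:
  assumes s: "s \<in> S0" and r: "r \<in> S0"
  shows "t (m s r) = m (t r) (t s)"
proof -
  have idems_comm: "m (m r (t r)) (m (t s) s) = m (m (t s) s) (m r (t r))"
    by (rule S0_idems_commute) (use s r in auto)
  have comm: "m r (m (t r) (m (t s) (m s z))) = m (t s) (m s (m r (m (t r) z)))" if "z \<in> S" for z
  proof -
    have "m (m (m r (t r)) (m (t s) s)) z = m (m (m (t s) s) (m r (t r))) z" using idems_comm by simp
    thus ?thesis using s r that by simp
  qed
  show ?thesis
  proof (rule tinv_eqI)
    show "m (m s r) (m (m (t r) (t s)) (m s r)) = m s r" using s r by (simp add: comm)
    show "m (m (t r) (t s)) (m (m s r) (m (t r) (t s))) = m (t r) (t s)" using s r by (simp flip: comm)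
  qed (use s r in auto)
qed

end

section \<open>The construction\<close>

locale construction =
  fixes S0 L mL R mR star
  assumes data: "construction_data S0 L mL R mR star"
begin

abbreviation tL where "tL \<equiv> tinv mL S0"
abbreviation tR where "tR \<equiv> tinv mR S0"

lemma L_left_inverse: "left_inverse_semigrp L mL"
  and R_right_inverse: "right_inverse_semigrp R mR"
  and mult_agree: "s \<in> S0 \<Longrightarrow> r \<in> S0 \<Longrightarrow> mR s r = mL s r"
  and star_in_S0[simp]: "a \<in> R \<Longrightarrow> x \<in> L \<Longrightarrow> star a x \<in> S0"
  and star_axiom: "y \<in> L \<Longrightarrow> z \<in> L \<Longrightarrow> a \<in> R \<Longrightarrow> b \<in> R \<Longrightarrow> tL y = tR b \<Longrightarrow>
        star (mR (star a y) (mR (tR b) b)) z = star a (mL (mL y (tL y)) (star b z))"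
  and star_S0_left_axiom: "a \<in> R \<Longrightarrow> x \<in> L \<Longrightarrow> a \<in> S0 \<Longrightarrow> star a x = mL a x"
  and star_S0_right_axiom: "a \<in> R \<Longrightarrow> x \<in> L \<Longrightarrow> x \<in> S0 \<Longrightarrow> star a x = mR a x"
  and star_idems: "e \<in> idems R mR \<Longrightarrow> f \<in> idems L mL \<Longrightarrow> star e f \<in> idems S0 mL"
  using data unfolding construction_data_def by auto

sublocale Lt: inv_transversal L mL S0
  using data
  unfolding construction_data_def inv_transversal_def left_inverse_semigrp_def regular_semigrp_def
  by auto
sublocale Rt: inv_transversal R mR S0
  using data
  unfolding construction_data_def inv_transversal_def right_inverse_semigrp_def regular_semigrp_def
  by auto

lemma tinvR_S0 [simp]: "s \<in> S0 \<Longrightarrow> tR s = tL s"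
  by (rule Rt.tinv_eqI) (auto simp: mult_agree)

lemma R_S0_tinv_simps [simp]:
  assumes "s \<in> S0"
  shows "mR s (mR (tL s) s) = s" and "mR (tL s) (mR s (tL s)) = tL s"
    and "z \<in> R \<Longrightarrow> mR s (mR (tL s) (mR s z)) = mR s z"
    and "z \<in> R \<Longrightarrow> mR (tL s) (mR s (mR (tL s) z)) = mR (tL s) z"
  using assms Rt.mult_tinv_mult[of s] Rt.tinv_mult_tinv[of s]
    Rt.mult_tinv_mult_left[of s z] Rt.tinv_mult_tinv_left[of s z] by simp_all

lemma multR_multL_S0 [simp]:
  "s \<in> S0 \<Longrightarrow> r \<in> S0 \<Longrightarrow> z \<in> R \<Longrightarrow> mR (mL s r) z = mR s (mR r z)"
  by (simp flip: mult_agree)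

lemma star_S0_left [simp]: "s \<in> S0 \<Longrightarrow> x \<in> L \<Longrightarrow> star s x = mL s x"
  by (rule star_S0_left_axiom) auto

lemma star_S0_right [simp]: "a \<in> R \<Longrightarrow> s \<in> S0 \<Longrightarrow> star a s = mR a s"
  by (rule star_S0_right_axiom) auto

lemma multL_in_S0 [simp]: "s \<in> S0 \<Longrightarrow> x \<in> L \<Longrightarrow> mL s x \<in> S0"
  by (metis Rt.S0_memD star_in_S0 star_S0_left)

lemma multR_in_S0 [simp]: "a \<in> R \<Longrightarrow> s \<in> S0 \<Longrightarrow> mR a s \<in> S0"
  by (metis Lt.S0_memD star_in_S0 star_S0_right)

lemma multL_multR_assoc:
  assumes a: "a \<in> R" and s: "s \<in> S0" and z: "z \<in> L"
  shows "mL (mR a s) z = mR a (mL s z)"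
proof -
  have "star (mR (star a s) (mR (tR s) s)) z = star a (mL (mL s (tL s)) (star s z))"
    by (rule star_axiom) (use a s z in auto)
  thus ?thesis using a s z by simp
qed

lemma L_tinv_mult:
  assumes x: "x \<in> L"
  shows "mL (tL x) x = mL (tL x) (tL (tL x))"
proof -
  let ?e = "mL (tL x) x" and ?f = "mL (tL x) (tL (tL x))"
  have e: "?e \<in> idems L mL" using x unfolding idems_def by simp
  have f: "?f \<in> idems L mL" using x unfolding idems_def by simp
  have ef: "mL ?e ?f = ?f" using x by simp
  have fe: "mL ?f ?e = ?e" using x by simp
  have "mL (mL ?e ?f) ?e = mL ?e ?f" using L_left_inverse e f unfolding left_inverse_semigrp_def by blast
  thus ?thesis using ef fe by simp
qed

lemma R_mult_tinv:
  assumes a: "a \<in> R"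
  shows "mR a (tR a) = mL (tL (tR a)) (tR a)"
proof -
  let ?e = "mR a (tR a)" and ?f = "mR (tR (tR a)) (tR a)"
  have e: "?e \<in> idems R mR" using a unfolding idems_def by simp
  have f: "?f \<in> idems R mR" using a unfolding idems_def by simp
  have ef: "mR ?e ?f = ?e" using a by simp
  have fe: "mR ?f ?e = ?f" using a by simp
  have "mR (mR ?e ?f) ?e = mR ?f ?e" using R_right_inverse e f unfolding right_inverse_semigrp_def by blast
  thus ?thesis using ef fe a by (simp add: mult_agree)
qed

lemma L_mult_tinv_tinv [simp]: "x \<in> L \<Longrightarrow> mL x (mL (tL x) (tL (tL x))) = x"
  by (simp flip: L_tinv_mult)

lemma R_tinv_tinv_mult [simp]:
  assumes a: "a \<in> R"
  shows "mR (tL (tR a)) (mR (tR a) a) = a"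
proof -
  have "mR (mR a (tR a)) a = a" using a by simp
  hence "mR (mR (tL (tR a)) (tR a)) a = a" using a by (simp add: R_mult_tinv mult_agree del: Rt.assoc)
  thus ?thesis using a by simp
qed

lemma star_left_absorb:
  assumes a: "a \<in> R" and z: "z \<in> L"
  shows "mL (tL (tR a)) (mL (tR a) (star a z)) = star a z"
proof -
  let ?u = "tR a"
  let ?c = "mL (tL ?u) ?u" and ?y = "tL ?u"
  have u: "?u \<in> S0" using a by simp
  have "star (mR (star ?c ?y) (mR (tR a) a)) z = star ?c (mL (mL ?y (tL ?y)) (star a z))"
    by (rule star_axiom) (use a z u in auto)
  moreover have "star ?c ?y = tL ?u" using u by simp
  moreover have "star ?c (mL (mL ?y (tL ?y)) (star a z)) = mL (tL ?u) (mL ?u (star a z))"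
    using u a z by simp
  ultimately show ?thesis using a by simp
qed

lemma star_right_absorb:
  assumes a: "a \<in> R" and y: "y \<in> L"
  shows "mL (star a y) (mL (tL y) (tL (tL y))) = star a y"
proof -
  let ?v = "tL y"
  let ?b = "tL ?v" and ?z = "mL ?v (tL ?v)"
  have v: "?v \<in> S0" using y by simp
  have "star (mR (star a y) (mR (tR ?b) ?b)) ?z = star a (mL (mL y (tL y)) (star ?b ?z))"
    by (rule star_axiom) (use a y v in auto)
  moreover have "star ?b ?z = ?b" using v by simp
  moreover have "mL (mL y (tL y)) ?b = y" using y by simp
  moreover have "mR (star a y) (mR (tR ?b) ?b) = mL (star a y) ?z" using v a y
    by (simp add: mult_agree)
  moreover have "star (mL (star a y) ?z) ?z = mL (star a y) ?z" using v a y by simp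
  ultimately show ?thesis by simp
qed

lemma tinvL_mult:
  assumes x: "x \<in> L" and w: "w \<in> S0"
    and H: "mL (tL (tL x)) (mL (tL x) w) = w"
  shows "tL (mL x (mL (tL x) w)) = tL w"
proof -
  define u where "u = tL x"
  define W where "W = tL w"
  have u: "u \<in> S0" and W: "W \<in> S0" using x w unfolding u_def W_def by auto
  have H': "mL W (mL (tL u) u) = W"
  proof -
    have "tL (mL (tL u) (mL u w)) = W" using H unfolding u_def W_def by simp
    thus ?thesis using u w unfolding W_def by (simp add: Lt.tinv_mult_S0)
  qed
  have "mL W (mL x u) = mL (mL W (mL (tL u) u)) (mL x u)" using H' by simp
  also have "\<dots> = mL W (mL (tL u) u)" using u W x unfolding u_def by simp
  finally have K: "mL W (mL x u) = W" using H' by simp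
  have Kz: "\<And>z. z \<in> L \<Longrightarrow> mL W (mL x (mL u z)) = mL W z"
  proof -
    fix z assume z: "z \<in> L"
    have "mL (mL W (mL x u)) z = mL W z" using K by simp
    thus "?thesis z" using z u W x by simp
  qed
  show ?thesis unfolding u_def[symmetric]
    by (rule Lt.tinv_eqI) (use x u w W in \<open>simp_all add: Kz[unfolded W_def]\<close>)
qed

lemma tinvR_mult:
  assumes b: "b \<in> R" and w: "w \<in> S0"
    and H: "mL w (mL (tR b) (tL (tR b))) = w"
  shows "tR (mR w (mR (tR b) b)) = tL w"
proof -
  define v where "v = tR b"
  define W where "W = tL w"
  have v: "v \<in> S0" and W: "W \<in> S0" using b w unfolding v_def W_def by auto
  have H': "mL v (mL (tL v) W) = W"
  proof -
    have "tL (mL w (mL v (tL v))) = W" using H unfolding v_def W_def by simp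
    thus ?thesis using v w unfolding W_def by (simp add: Lt.tinv_mult_S0)
  qed
  have "mR v (mR b W) = mR v (mR b (mR v (mR (tL v) W)))"
    using H' v W by (simp add: mult_agree)
  also have "\<dots> = mR v (mR (tL v) W)" unfolding v_def using b W by simp
  also have "\<dots> = W" using H' v W by (simp add: mult_agree)
  finally have K: "mR v (mR b W) = W" .
  have Kz: "\<And>z. z \<in> R \<Longrightarrow> mR v (mR b (mR W z)) = mR W z"
  proof -
    fix z assume z: "z \<in> R"
    have "mR (mR v (mR b W)) z = mR W z" using K by simp
    thus "?thesis z" using z v W b by simp
  qed
  show ?thesis unfolding v_def[symmetric]
    by (rule Rt.tinv_eqI) (use b v w W in \<open>simp_all add: Kz[unfolded W_def] K[unfolded W_def]\<close>)
qed

abbreviation T where "T \<equiv> Tset S0 L mL R mR"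
abbreviation tm where "tm \<equiv> Tmult S0 mL mR star"

lemma Tmult_simp: "tm (x, a) (y, b) = (mL (mL x (tL x)) (star a y), mR (star a y) (mR (tR b) b))"
  by (simp add: Tmult_def)

lemma Tset_iff: "(x, a) \<in> T \<longleftrightarrow> x \<in> L \<and> a \<in> R \<and> tL x = tR a"
  by (simp add: Tset_def)

lemma tinv_Tmult:
  assumes x: "x \<in> L" and a: "a \<in> R" and xa: "tL x = tR a"
    and y: "y \<in> L" and b: "b \<in> R" and yb: "tL y = tR b"
  shows "tL (mL x (mL (tL x) (star a y))) = tL (star a y)"
    and "tR (mR (star a y) (mR (tR b) b)) = tL (star a y)"
proof -
  show "tL (mL x (mL (tL x) (star a y))) = tL (star a y)"
    by (rule tinvL_mult) (use x a y star_left_absorb[OF a y] xa in auto)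
  show "tR (mR (star a y) (mR (tR b) b)) = tL (star a y)"
    by (rule tinvR_mult) (use b a y star_right_absorb[OF a y] yb in auto)
qed

lemma Tmult_closed:
  assumes p: "p \<in> T" and q: "q \<in> T"
  shows "tm p q \<in> T"
proof -
  obtain x a where pa: "p = (x, a)" by (cases p)
  obtain y b where qb: "q = (y, b)" by (cases q)
  have h: "x \<in> L" "a \<in> R" "tL x = tR a" "y \<in> L" "b \<in> R" "tL y = tR b"
    using p q unfolding pa qb Tset_iff by auto
  show ?thesis unfolding pa qb Tmult_simp Tset_iff using tinv_Tmult[OF h] h by simp
qed

lemma Tmult_Tmult_left:
  assumes x: "x \<in> L" and a: "a \<in> R" and xa: "tL x = tR a"
    and y: "y \<in> L" and b: "b \<in> R" and yb: "tL y = tR b" and z: "z \<in> L"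
  defines "v \<equiv> star (snd (tm (x, a) (y, b))) z"
  shows "tm (tm (x, a) (y, b)) (z, c) = (mL x (mL (tL x) v), mR v (mR (tR c) c))"
proof -
  let ?w = "star a y"
  let ?P = "mL x (mL (tL x) ?w)" and ?Q = "mR ?w (mR (tR b) b)"
  have w: "?w \<in> S0" and Q: "?Q \<in> R" using a b y by auto
  have tPQ: "tL ?P = tL ?w" "tR ?Q = tL ?w" using tinv_Tmult[OF x a xa y b yb] by auto
  have pq: "tm (x, a) (y, b) = (?P, ?Q)" unfolding Tmult_simp using x w by simp
  have v: "v \<in> S0" unfolding v_def pq using Q z by simp
  have "mL ?w (mL (tL ?w) v) = v"
    using star_left_absorb[OF Q z] tPQ w unfolding v_def pq by simp
  thus ?thesis unfolding pq unfolding Tmult_simp v_def[unfolded pq snd_conv, symmetric]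
    using x w v tPQ(1) by simp
qed

lemma Tmult_Tmult_right:
  assumes x: "x \<in> L" and a: "a \<in> R" and y: "y \<in> L" and b: "b \<in> R" and yb: "tL y = tR b"
    and z: "z \<in> L" and c: "c \<in> R" and zc: "tL z = tR c"
  defines "v \<equiv> star a (fst (tm (y, b) (z, c)))"
  shows "tm (x, a) (tm (y, b) (z, c)) = (mL x (mL (tL x) v), mR v (mR (tR c) c))"
proof -
  let ?w = "star b z"
  let ?P = "mL y (mL (tL y) ?w)" and ?Q = "mR ?w (mR (tR c) c)"
  have w: "?w \<in> S0" and P: "?P \<in> L" using b y z by auto
  have tPQ: "tL ?P = tL ?w" "tR ?Q = tL ?w" using tinv_Tmult[OF y b yb z c zc] by auto
  have qr: "tm (y, b) (z, c) = (?P, ?Q)" unfolding Tmult_simp using y w by simp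
  have v: "v \<in> S0" unfolding v_def qr using a P by simp
  have "mL v (mL (tL ?w) ?w) = v"
    using star_right_absorb[OF a P] tPQ w unfolding v_def qr by simp
  hence vw: "mR v (mR (tL ?w) ?w) = v" using v w by (simp add: mult_agree)
  have "mR v (mR (tL ?w) (mR ?w (mR (tR c) c))) = mR (mR v (mR (tL ?w) ?w)) (mR (tR c) c)"
    using v w c by simp
  hence "mR v (mR (tL ?w) (mR ?w (mR (tR c) c))) = mR v (mR (tR c) c)" unfolding vw .
  thus ?thesis unfolding qr unfolding Tmult_simp v_def[unfolded qr fst_conv, symmetric]
    using x v tPQ(2) by simp
qed

text \<open>Axiom (1) says exactly that the two bracketings of \<open>(x, a)(y, b)(z, c)\<close> give the same value
  of \<open>\<ast>\<close> in the middle.\<close>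

lemma Tmult_assoc:
  assumes p: "p \<in> T" and q: "q \<in> T" and r: "r \<in> T"
  shows "tm (tm p q) r = tm p (tm q r)"
proof -
  obtain x a y b z c where pqr: "p = (x, a)" "q = (y, b)" "r = (z, c)"
    by (cases p, cases q, cases r)
  have h: "x \<in> L" "a \<in> R" "tL x = tR a" "y \<in> L" "b \<in> R" "tL y = tR b" "z \<in> L" "c \<in> R" "tL z = tR c"
    using p q r unfolding pqr Tset_iff by auto
  have "star (snd (tm (x, a) (y, b))) z = star a (fst (tm (y, b) (z, c)))"
    unfolding Tmult_simp using star_axiom[of y z a b] h by simp
  thus ?thesis unfolding pqr
    using Tmult_Tmult_left[OF h(1-7)] Tmult_Tmult_right[OF h(1,2,4-9)] by simp
qed

lemma semigrp_T: "semigrp T tm"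
  unfolding semigrp_def using Tmult_closed Tmult_assoc by blast

definition T0 where "T0 = (\<lambda>s. (s, s)) ` S0"

lemma Tmult_diag: "s \<in> S0 \<Longrightarrow> r \<in> S0 \<Longrightarrow> tm (s, s) (r, r) = (mL s r, mL s r)"
  unfolding Tmult_simp by (simp add: mult_agree)

lemma T0_subset: "T0 \<subseteq> T"
  unfolding T0_def by (auto simp: Tset_iff)

lemma Tmult_tinv_right:
  assumes x: "x \<in> L" and a: "a \<in> R" and xa: "tL x = tR a"
  shows "tm (x, a) (tL x, tL x) = (mL x (tL x), mL (tL (tL x)) (tL x))"
proof -
  have "mR a (tL x) = mL (tL (tL x)) (tL x)" using R_mult_tinv[OF a] xa by simp
  thus ?thesis unfolding Tmult_simp using x a by (simp add: mult_agree)
qed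

lemma Tmult_tinv_left:
  assumes x: "x \<in> L" and a: "a \<in> R" and xa: "tL x = tR a"
  shows "tm (tL x, tL x) (x, a) = (mL (tL x) (tL (tL x)), mR (tL x) a)"
  unfolding Tmult_simp using x a L_tinv_mult[OF x] xa[symmetric] by simp

lemma is_inv_diag:
  assumes x: "x \<in> L" and a: "a \<in> R" and xa: "tL x = tR a"
  shows "is_inv tm (x, a) (tL x, tL x)"
proof -
  have "tm (mL x (tL x), mL (tL (tL x)) (tL x)) (x, a) = (x, a)"
  proof -
    have "tL (mL x (tL x)) = mL (tL (tL x)) (tL x)" by (rule Lt.tinv_eqI) (use x in simp_all)
    moreover have "mR (tL (tL x)) (mR (tL x) a) = a" using R_tinv_tinv_mult[OF a] xa by simp
    moreover have "mL (tL (tL x)) (mL (tL x) x) = tL (tL x)" using x by (simp add: L_tinv_mult)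
    ultimately show ?thesis unfolding Tmult_simp using x a xa[symmetric] by simp
  qed
  moreover have "tm (mL (tL x) (tL (tL x)), mR (tL x) a) (tL x, tL x) = (tL x, tL x)"
  proof -
    have "tL (mL (tL x) (tL (tL x))) = mL (tL x) (tL (tL x))" by (rule Lt.tinv_idem) (use x in simp_all)
    moreover have "mR (tL x) (mR a (tL x)) = tL x"
    proof -
      have "mR a (tL x) = mL (tL (tL x)) (tL x)" using R_mult_tinv[OF a] xa by simp
      thus ?thesis using x by (simp add: mult_agree)
    qed
    ultimately show ?thesis unfolding Tmult_simp using x a by simp
  qed
  ultimately show ?thesis unfolding is_inv_def
    using Tmult_tinv_right[OF x a xa] Tmult_tinv_left[OF x a xa] by simp
qed

text \<open>Reading off the components of \<open>(x, a)(s, s)(x, a) = (x, a)\<close> and \<open>(s, s)(x, a)(s, s) = (s, s)\<close>,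
  with \<open>u = x\<^sup>0\<close>, \<open>\<beta> = as\<close> and \<open>\<alpha> = sx\<close>.\<close>

lemma diag_inverse_eqs:
  assumes x: "x \<in> L" and a: "a \<in> R" and xa: "tL x = tR a" and s: "s \<in> S0"
    and inv: "is_inv tm (x, a) (s, s)"
  shows "mL x (mL (tL x) (mL (mR a s) x)) = x"
    and "mR (mL (mR a s) x) (mR (tL x) a) = a"
    and "mL (mL s x) (mL (tL x) (mR a s)) = s"
proof -
  let ?u = "tL x" and ?\<beta> = "mR a s" and ?\<alpha> = "mL s x"
  have u: "?u \<in> S0" and \<beta>: "?\<beta> \<in> S0" and \<alpha>: "?\<alpha> \<in> S0" using x a s by auto
  have "mL (tL ?u) (mL ?u ?\<beta>) = ?\<beta>" using star_left_absorb[OF a, of s] a s xa by simp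
  hence tX: "tL (mL x (mL ?u ?\<beta>)) = tL ?\<beta>" by (intro tinvL_mult) (use x \<beta> in auto)
  have "tm (x, a) (s, s) = (mL x (mL ?u ?\<beta>), ?\<beta>)" unfolding Tmult_simp using x a s by simp
  moreover have "tm (mL x (mL ?u ?\<beta>), ?\<beta>) (x, a) = (mL x (mL ?u (mL ?\<beta> x)), mR (mL ?\<beta> x) (mR ?u a))"
    unfolding Tmult_simp tX using x a s \<beta> xa[symmetric] by simp
  ultimately have "tm (tm (x, a) (s, s)) (x, a) = (mL x (mL ?u (mL ?\<beta> x)), mR (mL ?\<beta> x) (mR ?u a))"
    by simp
  thus "mL x (mL ?u (mL ?\<beta> x)) = x" and "mR (mL ?\<beta> x) (mR ?u a) = a"
    using inv unfolding is_inv_def by simp_all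
  have "tm (s, s) (x, a) = (?\<alpha>, mR ?\<alpha> (mR ?u a))"
    unfolding Tmult_simp using x a s xa[symmetric] by simp
  moreover have "star (mR ?\<alpha> (mR ?u a)) s = mL ?\<alpha> (mL ?u ?\<beta>)"
    using \<alpha> u a s \<beta> by (simp add: mult_agree)
  ultimately have "fst (tm (tm (s, s) (x, a)) (s, s)) = mL ?\<alpha> (mL ?u ?\<beta>)"
    unfolding Tmult_simp using \<alpha> u \<beta> by simp
  thus "mL ?\<alpha> (mL ?u ?\<beta>) = s" using inv unfolding is_inv_def by simp
qed

text \<open>With \<open>\<sigma> = \<alpha>u\<close> and \<open>\<tau> = u\<beta>\<close> one has \<open>s = \<alpha>\<tau>\<close>, and \<open>\<sigma>\<close>, \<open>\<tau>\<close> turn out to be inverses of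
  \<open>a\<close> in \<open>R\<close> and of \<open>x\<close> in \<open>L\<close>, so both equal \<open>u\<close>, whence \<open>s = \<alpha>u = u\<close>.\<close>

lemma diag_inverse_unique:
  assumes x: "x \<in> L" and a: "a \<in> R" and xa: "tL x = tR a" and s: "s \<in> S0"
    and inv: "is_inv tm (x, a) (s, s)"
  shows "s = tL x"
proof -
  let ?u = "tL x" and ?\<beta> = "mR a s" and ?\<alpha> = "mL s x"
  let ?\<sigma> = "mL ?\<alpha> ?u" and ?\<tau> = "mL ?u ?\<beta>"
  have u: "?u \<in> S0" and \<beta>: "?\<beta> \<in> S0" and \<alpha>: "?\<alpha> \<in> S0" using x a s by auto
  have \<sigma>: "?\<sigma> \<in> S0" and \<tau>: "?\<tau> \<in> S0" using \<alpha> u \<beta> by auto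
  note E = diag_inverse_eqs[OF x a xa s inv]
  have a\<sigma>: "mR a ?\<sigma> = mL (mL ?\<beta> x) ?u"
    using multL_multR_assoc[OF a s, of "mL x ?u"] x s \<beta> by simp
  have a\<sigma>a: "mR a (mR ?\<sigma> a) = a"
  proof -
    have "mR a (mR ?\<sigma> a) = mR (mR a ?\<sigma>) a" using a \<sigma> by simp
    also have "\<dots> = mR (mL (mL ?\<beta> x) ?u) a" using a\<sigma> by simp
    also have "\<dots> = mR (mR (mL ?\<beta> x) ?u) a" using \<beta> x u by (simp add: mult_agree)
    also have "\<dots> = a" using E(2) \<beta> x u a by simp
    finally show ?thesis .
  qed
  have \<sigma>a\<sigma>: "mR ?\<sigma> (mR a ?\<sigma>) = ?\<sigma>"
  proof -
    have "mR ?\<sigma> (mR a ?\<sigma>) = mL (mL (mL ?\<alpha> (mL ?u ?\<beta>)) x) ?u"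
      using a\<sigma> \<sigma> \<alpha> \<beta> x u by (simp add: mult_agree)
    thus ?thesis using E(3) by simp
  qed
  have u\<sigma>: "?u = ?\<sigma>" using Rt.tinv_eqI[OF a \<sigma> a\<sigma>a \<sigma>a\<sigma>] xa by simp
  have \<tau>x\<tau>: "mL ?\<tau> (mL x ?\<tau>) = ?\<tau>"
  proof -
    have "mL (mL (mL ?\<beta> x) ?u) ?\<beta> = mR (mR a ?\<sigma>) ?\<beta>"
      using a\<sigma> a \<sigma> \<beta> by (simp flip: a\<sigma> add: mult_agree)
    also have "\<dots> = mR (mR (mR a ?\<sigma>) a) s" using a \<sigma> s by simp
    also have "\<dots> = ?\<beta>" using a\<sigma>a a \<sigma> by simp
    finally show ?thesis using u \<beta> x by simp
  qed
  have u\<tau>: "?u = ?\<tau>" by (rule Lt.tinv_eqI) (use x \<tau> E(1) \<tau>x\<tau> u \<beta> in simp_all)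
  have "s = mL ?\<alpha> ?\<tau>" using E(3) by simp
  also have "\<dots> = ?u" using u\<tau> u\<sigma> by simp
  finally show ?thesis .
qed

lemma ex1_inverse_in_T0:
  assumes z: "z \<in> T"
  shows "\<exists>!y. y \<in> T0 \<and> is_inv tm z y"
proof -
  obtain x a where za: "z = (x, a)" by (cases z)
  have h: "x \<in> L" "a \<in> R" "tL x = tR a" using z unfolding za Tset_iff by auto
  show ?thesis
  proof (rule ex1I[of _ "(tL x, tL x)"])
    show "(tL x, tL x) \<in> T0 \<and> is_inv tm z (tL x, tL x)"
      unfolding za T0_def using is_inv_diag[OF h] h by auto
    fix y assume "y \<in> T0 \<and> is_inv tm z y"
    then obtain s where "s \<in> S0" "y = (s, s)" "is_inv tm (x, a) (s, s)"
      unfolding T0_def za by auto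
    thus "y = (tL x, tL x)" using diag_inverse_unique[OF h] by simp
  qed
qed

lemma tinv_T:
  assumes "x \<in> L" "a \<in> R" "tL x = tR a"
  shows "tinv tm T0 (x, a) = (tL x, tL x)"
proof -
  have z: "(x, a) \<in> T" using assms unfolding Tset_iff by simp
  show ?thesis unfolding tinv_def[of tm T0 "(x, a)"]
    by (rule the1_equality[OF ex1_inverse_in_T0[OF z]])
      (use is_inv_diag[OF assms] assms in \<open>auto simp: T0_def\<close>)
qed

lemma tinvR_tinv_mult:
  assumes a: "a \<in> R"
  shows "tR (mR (tR a) a) = mL (tR a) (tL (tR a))"
proof -
  let ?u = "tR a"
  have u: "?u \<in> S0" using a by simp
  have au: "mR a (mR ?u z) = mR (tL ?u) (mR ?u z)" if "z \<in> R" for z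
  proof -
    have "mR (mR a ?u) z = mR (mL (tL ?u) ?u) z" using R_mult_tinv[OF a] by simp
    thus ?thesis using a u that by simp
  qed
  show ?thesis
  proof (rule Rt.tinv_eqI)
    show "mR (mR ?u a) (mR (mL ?u (tL ?u)) (mR ?u a)) = mR ?u a" using u a by (simp add: au)
    have "mR (mL ?u (tL ?u)) (mR (mR ?u a) (mL ?u (tL ?u)))
        = mR ?u (mR (tL ?u) (mR ?u (mR a (mR ?u (tL ?u)))))"
      using u a by (simp add: mult_agree)
    also have "\<dots> = mR ?u (mR (tL ?u) (mR ?u (tL ?u)))" using u a by (simp add: au)
    also have "\<dots> = mL ?u (tL ?u)" using u by (simp add: mult_agree)
    finally show "mR (mL ?u (tL ?u)) (mR (mR ?u a) (mL ?u (tL ?u))) = mL ?u (tL ?u)" .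
  qed (use u a in auto)
qed

text \<open>\<open>(x, a)\<^sup>0(x, a)(y, b)(y, b)\<^sup>0 = (e, e)\<close> with \<open>e = (x\<^sup>0a) \<ast> (yy\<^sup>0)\<close>, an idempotent by axiom (3).\<close>

lemma Tmult_Lambda_I:
  assumes x: "x \<in> L" and a: "a \<in> R" and xa: "tL x = tR a"
    and y: "y \<in> L" and b: "b \<in> R" and yb: "tL y = tR b"
  shows "\<exists>e. tm (tm (tL x, tL x) (x, a)) (tm (y, b) (tL y, tL y)) = (e, e) \<and> e \<in> S0 \<and> mL e e = e"
proof -
  let ?u = "tL x" and ?v = "tL y"
  let ?ua = "mR ?u a" and ?F = "mL (tL ?v) ?v"
  have u: "?u \<in> S0" and v: "?v \<in> S0" and ua: "?ua \<in> R" using x y a by auto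
  have tua: "tR ?ua = mL ?u (tL ?u)" using tinvR_tinv_mult[OF a] xa by simp
  have tyv: "tL (mL y ?v) = ?F" by (rule Lt.tinv_eqI) (use y v in simp_all)
  have tF: "tL ?F = ?F" by (rule Lt.tinv_idem) (use v in simp_all)
  have tE: "tL (mL ?u (tL ?u)) = mL ?u (tL ?u)" by (rule Lt.tinv_idem) (use u in simp_all)
  define e where "e = star ?ua (mL y ?v)"
  have eS: "e \<in> S0" unfolding e_def using ua y by simp
  have "?ua \<in> idems R mR" using a xa by (simp add: idems_def)
  moreover have "mL y ?v \<in> idems L mL" unfolding idems_def using y by simp
  ultimately have ee: "mL e e = e" using star_idems unfolding e_def idems_def by blast
  have l: "mL ?u (mL (tL ?u) e) = e"
    using star_left_absorb[OF ua, of "mL y ?v"] y u eS unfolding tua tE e_def[symmetric] by simp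
  have r: "mL e ?F = e"
    using star_right_absorb[OF ua, of "mL y ?v"] y v eS unfolding tyv tF e_def[symmetric] by simp
  have "tm (mL ?u (tL ?u), ?ua) (mL y ?v, ?F) = (e, e)"
    unfolding Tmult_simp tE e_def[symmetric] using l r eS u v tF by (simp add: mult_agree)
  hence "tm (tm (?u, ?u) (x, a)) (tm (y, b) (?v, ?v)) = (e, e)"
    unfolding Tmult_tinv_left[OF x a xa] Tmult_tinv_right[OF y b yb] .
  thus ?thesis using eS ee by blast
qed

lemma regular_T: "regular_semigrp T tm"
  unfolding regular_semigrp_def
proof (intro conjI ballI)
  show "semigrp T tm" by (rule semigrp_T)
  fix z assume "z \<in> T"
  then obtain y where "y \<in> T0" "is_inv tm z y" using ex1_inverse_in_T0 by blast
  thus "\<exists>y\<in>T. tm (tm z y) z = z" using T0_subset unfolding is_inv_def by blast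
qed

lemma inverse_transversal_T0: "inverse_transversal T tm T0"
proof -
  have "semigrp T0 tm"
    using Tmult_assoc T0_subset unfolding semigrp_def T0_def by (auto simp: Tmult_diag subset_iff)
  thus ?thesis unfolding inverse_transversal_def inverse_semigrp_def
    using T0_subset ex1_inverse_in_T0 by blast
qed

lemma multiplicative_T0: "multiplicative T tm T0"
  unfolding multiplicative_def
proof (intro ballI)
  fix p q assume p: "p \<in> T" and q: "q \<in> T"
  obtain x a y b where pq: "p = (x, a)" "q = (y, b)" by (cases p, cases q)
  have h: "x \<in> L" "a \<in> R" "tL x = tR a" "y \<in> L" "b \<in> R" "tL y = tR b"
    using p q unfolding pq Tset_iff by auto
  obtain e where e: "tm (tm (tL x, tL x) (x, a)) (tm (y, b) (tL y, tL y)) = (e, e)" "e \<in> S0" "mL e e = e"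
    using Tmult_Lambda_I[OF h] by blast
  have "(e, e) \<in> idems T0 tm" unfolding idems_def T0_def using e Tmult_diag by auto
  thus "tm (tm (tinv tm T0 p) p) (tm q (tinv tm T0 q)) \<in> idems T0 tm"
    unfolding pq tinv_T[OF h(1-3)] tinv_T[OF h(4-6)] e(1) .
qed

lemma T0_isomorphic_S0: "semigrp_isomorphic T0 tm S0 mL"
  unfolding semigrp_isomorphic_def semigrp_iso_def
proof (intro exI conjI)
  show "bij_betw fst T0 S0" unfolding bij_betw_def inj_on_def T0_def by force
  show "\<forall>p\<in>T0. \<forall>q\<in>T0. fst (tm p q) = mL (fst p) (fst q)"
    unfolding T0_def using Tmult_diag by auto
qed

end

section \<open>Multiplicative inverse transversals\<close>

lemma semigrp_flip: "semigrp S m \<Longrightarrow> semigrp S (\<lambda>x y. m y x)"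
  unfolding semigrp_def by simp

lemma is_inv_flip:
  assumes "semigrp S m" "x \<in> S" "y \<in> S"
  shows "is_inv (\<lambda>x y. m y x) x y \<longleftrightarrow> is_inv m x y"
  using assms unfolding semigrp_def is_inv_def by auto

lemma right_inverse_semigrp_if_flip:
  assumes flip: "left_inverse_semigrp S (\<lambda>x y. m y x)"
  shows "right_inverse_semigrp S m"
proof -
  have sg: "semigrp S m" using flip semigrp_flip[of S "\<lambda>x y. m y x"]
    unfolding left_inverse_semigrp_def regular_semigrp_def by simp
  have assoc: "m (m x y) z = m x (m y z)" if "x \<in> S" "y \<in> S" "z \<in> S" for x y z
    using sg that unfolding semigrp_def by blast
  have idems: "idems S (\<lambda>x y. m y x) = idems S m" unfolding idems_def by simp
  have "\<exists>y\<in>S. m (m x y) x = x" if "x \<in> S" for x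
    using flip that assoc unfolding left_inverse_semigrp_def regular_semigrp_def
    by (metis semigrp_def)
  moreover have "m e f \<in> idems S m \<and> m (m e f) e = m f e"
    if "e \<in> idems S m" "f \<in> idems S m" for e f
  proof -
    have "m e f \<in> idems S m" and "m e (m f e) = m f e"
      using flip that unfolding left_inverse_semigrp_def idems by auto
    thus ?thesis using that assoc unfolding idems_def by auto
  qed
  ultimately show ?thesis using sg unfolding right_inverse_semigrp_def regular_semigrp_def by blast
qed

locale mult_transversal = inv_transversal S m S0 for S m S0 +
  assumes multiplicative: "multiplicative S m S0"
begin

definition mid where "mid x y = m (t x) (m x (m y (t y)))"

lemma mid_in_S0: "x \<in> S \<Longrightarrow> y \<in> S \<Longrightarrow> mid x y \<in> S0"
  using multiplicative unfolding multiplicative_def idems_def mid_def by auto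

lemma mid_idem: "x \<in> S \<Longrightarrow> y \<in> S \<Longrightarrow> m (mid x y) (mid x y) = mid x y"
  using multiplicative unfolding multiplicative_def idems_def mid_def by auto

lemma mid_absorb:
  assumes x: "x \<in> S" and y: "y \<in> S"
  shows "z \<in> S \<Longrightarrow> m (t x) (m x (m (mid x y) z)) = m (mid x y) z"
    and "z \<in> S \<Longrightarrow> m (mid x y) (m y (m (t y) z)) = m (mid x y) z"
    and "z \<in> S \<Longrightarrow> m (mid x y) (m (mid x y) z) = m (mid x y) z"
    and "m x (m (mid x y) y) = m x y"
proof -
  show "z \<in> S \<Longrightarrow> m (t x) (m x (m (mid x y) z)) = m (mid x y) z"
    and "z \<in> S \<Longrightarrow> m (mid x y) (m y (m (t y) z)) = m (mid x y) z"
    and "m x (m (mid x y) y) = m x y"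
    using x y unfolding mid_def by simp_all
  show "z \<in> S \<Longrightarrow> m (mid x y) (m (mid x y) z) = m (mid x y) z"
    using mid_in_S0[OF x y] mid_idem[OF x y] by (simp add: idem_mult_left)
qed

lemma tinv_mult:
  assumes x: "x \<in> S" and y: "y \<in> S"
  shows "t (m x y) = m (t y) (m (mid x y) (t x))"
proof -
  define g where "g = mid x y"
  have g: "g \<in> S0" unfolding g_def using mid_in_S0[OF x y] .
  note absorb = mid_absorb[OF x y, folded g_def]
  show ?thesis unfolding g_def[symmetric]
  proof (rule tinv_eqI)
    have "m (m x (m g y)) (m (m (t y) (m g (t x))) (m x (m g y))) = m x (m g y)"
      using x y g by (simp add: absorb(1-3))
    thus "m (m x y) (m (m (t y) (m g (t x))) (m x y)) = m x y" by (simp only: absorb(4))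
    have "m (m (t y) (m g (t x))) (m (m x (m g y)) (m (t y) (m g (t x)))) = m (t y) (m g (t x))"
      using x y g by (simp add: absorb(1-3))
    thus "m (m (t y) (m g (t x))) (m (m x y) (m (t y) (m g (t x)))) = m (t y) (m g (t x))"
      by (simp only: absorb(4))
  qed (use x y g in auto)
qed

lemma tinv_idem_of_idem:
  assumes e: "e \<in> S" "m e e = e"
  shows "m (t e) (t e) = t e"
proof -
  have "mid e e = t e" unfolding mid_def using e by (simp add: idem_mult_left)
  thus ?thesis using mid_idem[of e e] e by simp
qed

text \<open>\<open>sxr = (sxx\<^sup>0)x\<^sup>0\<^sup>0(x\<^sup>0xr)\<close>, and both outer factors lie in \<open>S\<^sup>0\<close> by multiplicativity.\<close>

lemma quasi_ideal_S0: "quasi_ideal S m S0"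
  unfolding quasi_ideal_def
proof (intro ballI)
  fix s x r assume s: "s \<in> S0" and x: "x \<in> S" and r: "r \<in> S0"
  have "m s (mid s x) \<in> S0" and "m (mid x r) r \<in> S0" using mid_in_S0 x s r by simp_all
  hence sx: "m s (m x (t x)) \<in> S0" and xr: "m (t x) (m x r) \<in> S0"
    using x s r unfolding mid_def by simp_all
  have "m (m (m s (m x (t x))) (t (t x))) (m (t x) (m x r)) \<in> S0"
    by (rule S0_closed[OF S0_closed[OF sx]]) (use x xr in simp_all)
  thus "m (m s x) r \<in> S0" using x s r by simp
qed

definition Lset where "Lset = {x \<in> S. m (t x) x = m (t x) (t (t x))}"

lemma Lset_subset: "Lset \<subseteq> S"
  unfolding Lset_def by auto

lemma S0_subset_Lset: "S0 \<subseteq> Lset"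
  unfolding Lset_def by auto

lemma Lset_mult_tinv_tinv: "y \<in> Lset \<Longrightarrow> m y (m (t y) (t (t y))) = y"
  unfolding Lset_def by (auto simp flip: assoc) (metis assoc S0_memD mult_tinv_mult tinv_in_S0)

lemma Lset_closed:
  assumes x: "x \<in> Lset" and y: "y \<in> Lset"
  shows "m x y \<in> Lset"
proof -
  have xS: "x \<in> S" and yS: "y \<in> S" using x y unfolding Lset_def by auto
  define g where "g = mid x y"
  have g: "g \<in> S0" unfolding g_def using mid_in_S0 xS yS by simp
  note absorb = mid_absorb[OF xS yS, folded g_def]
  have xx: "m (t x) x = m (t x) (t (t x))" using x unfolding Lset_def by auto
  have xxz: "m (t x) (m (t (t x)) z) = m (t x) (m x z)" if z: "z \<in> S" for z
  proof -
    have "m (m (t x) (t (t x))) z = m (m (t x) x) z" using xx by simp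
    thus ?thesis using xS z by simp
  qed
  have tXY: "t (m x y) = m (t y) (m g (t x))" unfolding g_def by (rule tinv_mult[OF xS yS])
  have ttXY: "t (t (m x y)) = m (t (t x)) (m g (t (t y)))"
    unfolding tXY using g xS yS by (simp add: tinv_mult_S0 tinv_idem mid_idem g_def)
  have gyy: "m g (t (t y)) = m g y"
  proof -
    have "m g (t (t y)) = m g (m y (m (t y) (t (t y))))" using absorb(2)[of "t (t y)"] yS by simp
    also have "\<dots> = m g y" using Lset_mult_tinv_tinv[OF y] by simp
    finally show ?thesis .
  qed
  have "m (t (m x y)) (m x y) = m (t y) (m g (m (t x) (m x (m g y))))"
    unfolding tXY using absorb(4) xS yS g by simp
  also have "\<dots> = m (t y) (m g y)" using absorb(1,3) xS yS g by simp
  also have "\<dots> = m (t y) (m g (t (t y)))" using gyy by simp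
  also have "\<dots> = m (t y) (m g (m (t x) (m x (m g (t (t y))))))" using absorb(1,3) xS yS g by simp
  also have "\<dots> = m (t y) (m g (m (t x) (m (t (t x)) (m g (t (t y))))))" using xxz xS yS g by simp
  also have "\<dots> = m (t (m x y)) (t (t (m x y)))" unfolding ttXY unfolding tXY using xS yS g by simp
  finally show ?thesis unfolding Lset_def using xS yS by simp
qed

lemma Lset_idem:
  assumes e: "e \<in> Lset" "m e e = e"
  shows "m (t e) (t e) = t e" and "t (t e) = t e" and "m (t e) e = t e" and "m e (t e) = e"
proof -
  have eS: "e \<in> S" using e Lset_subset by auto
  show te: "m (t e) (t e) = t e" by (rule tinv_idem_of_idem) (use eS e in auto)
  show tte: "t (t e) = t e" using te eS by (simp add: tinv_idem)
  show E1: "m (t e) e = t e" using e te tte unfolding Lset_def by simp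
  have "m e (m (t e) e) = e" using eS by simp
  thus "m e (t e) = e" using E1 by simp
qed

lemma Lset_idems_tinv_mult:
  assumes e: "e \<in> Lset" "m e e = e" and f: "f \<in> Lset" "m f f = f"
  shows "m (t e) f = mid e f" and "t (m e f) = m (t e) f"
proof -
  have eS: "e \<in> S" and fS: "f \<in> S" using e f Lset_subset by auto
  note E = Lset_idem[OF e] and F = Lset_idem[OF f]
  show n_mid: "m (t e) f = mid e f"
    unfolding mid_def using eS fS E(3) F(4) by (metis assoc tinv_in_S0 S0_memD)
  define n where "n = m (t e) f"
  have n: "n \<in> S0" "m n n = n" unfolding n_def n_mid using mid_in_S0 mid_idem eS fS by auto
  have "t (m e f) = m (t f) (m n (t e))" unfolding n_def n_mid by (rule tinv_mult[OF eS fS])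
  also have "\<dots> = n"
  proof -
    have "m (t e) n = n" unfolding n_def using eS fS E(1) by (simp flip: assoc)
    moreover have "m n (t f) = n" unfolding n_def using eS fS F(4) by simp
    moreover have "m n (t e) = m (t e) n" and "m (t f) n = m n (t f)"
      using S0_idems_commute[OF n] E(1) F(1) eS fS by simp_all
    ultimately show ?thesis by simp
  qed
  finally show "t (m e f) = m (t e) f" unfolding n_def .
qed

lemma Lset_idems_left_regular:
  assumes e: "e \<in> idems Lset m" and f: "f \<in> idems Lset m"
  shows "m e f \<in> idems Lset m" and "m (m e f) e = m e f"
proof -
  have eL: "e \<in> Lset" "m e e = e" and fL: "f \<in> Lset" "m f f = f"
    using e f unfolding idems_def by auto
  have eS: "e \<in> S" and fS: "f \<in> S" using eL fL Lset_subset by auto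
  have E2z: "m e (m (t e) z) = m e z" and F2z: "m f (m (t f) z) = m f z" if "z \<in> S" for z
    using Lset_idem(4)[OF eL] Lset_idem(4)[OF fL] eS fS that by (metis assoc tinv_in_S0 S0_memD)+
  define n where "n = m (t e) f"
  define k where "k = m (t f) e"
  have n: "n \<in> S0" "m n n = n" unfolding n_def Lset_idems_tinv_mult(1)[OF eL fL]
    using mid_in_S0 mid_idem eS fS by auto
  have k: "k \<in> S0" "m k k = k" unfolding k_def Lset_idems_tinv_mult(1)[OF fL eL]
    using mid_in_S0 mid_idem eS fS by auto
  have efL: "m e f \<in> Lset" by (rule Lset_closed[OF eL(1) fL(1)])
  hence "m n (m e f) = n"
    using Lset_idems_tinv_mult(2)[OF eL fL] tinv_idem[OF n] n(2) unfolding Lset_def n_def by simp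
  hence "n = m (m n k) f" unfolding n_def k_def using eS fS by (simp add: F2z)
  also have "\<dots> = m (m k n) f" using S0_idems_commute[OF n k] by simp
  also have "\<dots> = m k n" unfolding n_def using eS fS k(1) fL(2) by simp
  finally have nk: "m n k = n" using S0_idems_commute[OF n k] by simp
  have "m (m e f) e = m e (m n k)" unfolding n_def k_def using eS fS by (simp add: E2z F2z)
  also have "\<dots> = m e f" unfolding nk unfolding n_def using eS fS by (simp add: E2z)
  finally show efe: "m (m e f) e = m e f" .
  have "m (m e f) (m e f) = m (m (m e f) e) f" using eS fS by simp
  also have "\<dots> = m e f" using efe eS fS fL(2) by (simp add: idem_mult_left)
  finally show "m e f \<in> idems Lset m" using efL unfolding idems_def by simp
qed

lemma Lset_left_inverse: "left_inverse_semigrp Lset m"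
  unfolding left_inverse_semigrp_def regular_semigrp_def semigrp_def
proof (intro conjI ballI)
  show "m x y \<in> Lset" if "x \<in> Lset" "y \<in> Lset" for x y using Lset_closed that .
  show "m (m x y) z = m x (m y z)" if "x \<in> Lset" "y \<in> Lset" "z \<in> Lset" for x y z
    using that Lset_subset by (simp add: subset_iff)
  show "\<exists>y\<in>Lset. m (m x y) x = x" if "x \<in> Lset" for x
    using that Lset_subset S0_subset_Lset by (intro bexI[of _ "t x"]) (auto simp: subset_iff)
  show "m e f \<in> idems Lset m" "m (m e f) e = m e f"
    if "e \<in> idems Lset m" "f \<in> idems Lset m" for e f
    using Lset_idems_left_regular that by auto
qed

lemma tinv_flip: "x \<in> S \<Longrightarrow> tinv (\<lambda>x y. m y x) S0 x = t x"
  unfolding tinv_def using is_inv_flip[OF semigrp] by (metis S0_memD)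

lemma mult_transversal_flip: "mult_transversal S (\<lambda>x y. m y x) S0"
proof -
  have S0: "semigrp S0 m" "\<forall>x\<in>S0. \<exists>!y. y \<in> S0 \<and> is_inv m x y"
    using transversal unfolding inverse_transversal_def inverse_semigrp_def by blast+
  have "\<forall>x\<in>S0. \<exists>!y. y \<in> S0 \<and> is_inv (\<lambda>x y. m y x) x y"
  proof
    fix x assume "x \<in> S0"
    moreover have "y \<in> S0 \<and> is_inv (\<lambda>x y. m y x) x y \<longleftrightarrow> y \<in> S0 \<and> is_inv m x y" for y
      using is_inv_flip[OF semigrp, of x y] \<open>x \<in> S0\<close> by auto
    ultimately show "\<exists>!y. y \<in> S0 \<and> is_inv (\<lambda>x y. m y x) x y" using S0(2) by simp
  qed
  hence "inverse_semigrp S0 (\<lambda>x y. m y x)"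
    using semigrp_flip[OF S0(1)] unfolding inverse_semigrp_def by blast
  moreover have "\<exists>!y. y \<in> S0 \<and> is_inv (\<lambda>x y. m y x) x y" if "x \<in> S" for x
    using ex1_inverse_in_S0[OF that] is_inv_flip[OF semigrp that] by (metis S0_memD)
  moreover have "multiplicative S (\<lambda>x y. m y x) S0"
    using multiplicative tinv_flip unfolding multiplicative_def idems_def by auto
  ultimately show ?thesis
    using semigrp_flip[OF semigrp] S0_subset
    unfolding mult_transversal_def mult_transversal_axioms_def inv_transversal_def inverse_transversal_def
    by blast
qed

definition Rset where "Rset = {a \<in> S. m a (t a) = m (t (t a)) (t a)}"

text \<open>The properties of \<open>Rset\<close> are obtained from those of \<open>Lset\<close> in the opposite semigroup.\<close>

lemma Rset_eq_flip_Lset: "Rset = mult_transversal.Lset S (\<lambda>x y. m y x) S0"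
  unfolding mult_transversal.Lset_def[OF mult_transversal_flip] Rset_def using tinv_flip by auto

lemma Rset_subset: "Rset \<subseteq> S"
  unfolding Rset_def by auto

lemma S0_subset_Rset: "S0 \<subseteq> Rset"
  unfolding Rset_def by auto

lemma Rset_right_inverse: "right_inverse_semigrp Rset m"
  using mult_transversal.Lset_left_inverse[OF mult_transversal_flip]
  by (intro right_inverse_semigrp_if_flip) (simp add: Rset_eq_flip_Lset)

lemma Rset_tinv_tinv_mult: "a \<in> Rset \<Longrightarrow> m (t (t a)) (m (t a) a) = a"
  using mult_transversal.Lset_mult_tinv_tinv[OF mult_transversal_flip, of a] Rset_subset tinv_flip
  by (auto simp: Rset_eq_flip_Lset)

lemma Rset_idem: "a \<in> Rset \<Longrightarrow> m a a = a \<Longrightarrow> m (t a) a = a"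
  using mult_transversal.Lset_idem(4)[OF mult_transversal_flip, of a] Rset_subset tinv_flip
  by (auto simp: Rset_eq_flip_Lset)

lemma Rset_mult_tinv:
  assumes a: "a \<in> Rset" and z: "z \<in> S"
  shows "m a (m (t a) z) = m (t (t a)) (m (t a) z)"
proof -
  have aS: "a \<in> S" and "m a (t a) = m (t (t a)) (t a)" using a unfolding Rset_def by auto
  hence "m (m a (t a)) z = m (m (t (t a)) (t a)) z" by simp
  thus ?thesis using aS z by simp
qed

lemma Rset_mult_Lset:
  assumes a: "a \<in> Rset" and x: "x \<in> Lset"
  shows "m a x \<in> S0"
proof -
  have aS: "a \<in> S" and xS: "x \<in> S" using a x Rset_subset Lset_subset by auto
  have "m (t (t a)) (m (mid a x) (t (t x))) \<in> S0" using mid_in_S0 aS xS by simp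
  moreover have "m (t (t a)) (m (mid a x) (t (t x))) = m a x"
    unfolding mid_def using aS xS Lset_mult_tinv_tinv[OF x] by (simp flip: Rset_mult_tinv[OF a])
  ultimately show ?thesis by simp
qed

lemma construction_data_Lset_Rset: "construction_data S0 Lset m Rset m m"
proof -
  have inv0: "inverse_semigrp S0 m" using transversal unfolding inverse_transversal_def by blast
  have "inverse_transversal Lset m S0" and "inverse_transversal Rset m S0"
    unfolding inverse_transversal_def
    using S0_subset_Lset S0_subset_Rset Lset_subset Rset_subset inv0 ex1_inverse_in_S0 by blast+
  moreover have "quasi_ideal Lset m S0" and "quasi_ideal Rset m S0"
    using quasi_ideal_S0 Lset_subset Rset_subset unfolding quasi_ideal_def by blast+
  moreover have "m (m (m a y) (m (t b) b)) z = m a (m (m y (t y)) (m b z))"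
    if "y \<in> Lset" "z \<in> Lset" "a \<in> Rset" "b \<in> Rset" "t y = t b" for y z a b
  proof -
    have "y \<in> S" "z \<in> S" "a \<in> S" "b \<in> S" using that Lset_subset Rset_subset by auto
    thus ?thesis using \<open>t y = t b\<close> by simp
  qed
  moreover have "m e f \<in> idems S0 m" if e: "e \<in> idems Rset m" and f: "f \<in> idems Lset m" for e f
  proof -
    have eR: "e \<in> Rset" "m e e = e" and fL: "f \<in> Lset" "m f f = f" using e f unfolding idems_def by auto
    have eS: "e \<in> S" and fS: "f \<in> S" using eR fL Rset_subset Lset_subset by auto
    have "mid e f = m e f"
      unfolding mid_def using eS fS Rset_idem[OF eR] Lset_idem(4)[OF fL] by (simp flip: assoc)
    thus ?thesis using mid_in_S0[OF eS fS] mid_idem[OF eS fS] unfolding idems_def by simp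
  qed
  ultimately show ?thesis unfolding construction_data_def
    using inv0 Lset_left_inverse Rset_right_inverse Rset_mult_Lset by blast
qed

definition to_S where "to_S p = m (m (fst p) (t (fst p))) (snd p)"
definition to_T where "to_T z = (m z (m (t z) (t (t z))), m (t (t z)) (m (t z) z))"

lemma Tset_Lset_Rset_iff: "(x, a) \<in> Tset S0 Lset m Rset m \<longleftrightarrow> x \<in> Lset \<and> a \<in> Rset \<and> t x = t a"
  by (simp add: Tset_def)

lemma to_S_hom:
  assumes p: "p \<in> Tset S0 Lset m Rset m" and q: "q \<in> Tset S0 Lset m Rset m"
  shows "to_S (Tmult S0 m m m p q) = m (to_S p) (to_S q)"
proof -
  obtain x a y b where pq: "p = (x, a)" "q = (y, b)" by (cases p, cases q)
  have x: "x \<in> Lset" and a: "a \<in> Rset" and xa: "t x = t a" and y: "y \<in> Lset" and b: "b \<in> Rset"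
    and yb: "t y = t b" using p q unfolding pq Tset_Lset_Rset_iff by auto
  have S: "x \<in> S" "a \<in> S" "y \<in> S" "b \<in> S" using x a y b Lset_subset Rset_subset by auto
  have tP: "t (m x (m (t x) (m a y))) = t (m a y)"
    using construction.tinv_Tmult(1)[OF construction.intro[OF construction_data_Lset_Rset] x a xa y b yb]
    by simp
  have ay: "m a (m y (m (t (m a y)) (m a (m y z)))) = m a (m y z)" if "z \<in> S" for z
    using mult_tinv_mult_left[of "m a y" z] S that by simp
  have "to_S (Tmult S0 m m m p q) = m x (m (t x) (m a (m y (m (t b) b))))"
    unfolding pq Tmult_def to_S_def using S tP by (simp add: ay)
  also have "\<dots> = m (to_S p) (to_S q)" unfolding pq to_S_def using S yb by simp
  finally show ?thesis .
qed

lemma to_T_in_Tset: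
  assumes z: "z \<in> S"
  shows "to_T z \<in> Tset S0 Lset m Rset m"
proof -
  let ?X = "m z (m (t z) (t (t z)))" and ?A = "m (t (t z)) (m (t z) z)"
  have tX: "t ?X = t z" by (rule tinv_eqI) (use z in simp_all)
  have tA: "t ?A = t z" by (rule tinv_eqI) (use z in simp_all)
  have "?X \<in> Lset" unfolding Lset_def using z tX by simp
  moreover have "?A \<in> Rset" unfolding Rset_def using z tA by simp
  ultimately show ?thesis unfolding to_T_def Tset_Lset_Rset_iff using tX tA by simp
qed

lemma to_S_to_T:
  assumes z: "z \<in> S"
  shows "to_S (to_T z) = z"
proof -
  have "t (m z (m (t z) (t (t z)))) = t z" by (rule tinv_eqI) (use z in simp_all)
  thus ?thesis unfolding to_S_def to_T_def using z by simp
qed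

lemma to_T_to_S:
  assumes p: "p \<in> Tset S0 Lset m Rset m"
  shows "to_T (to_S p) = p"
proof -
  obtain x a where pa: "p = (x, a)" by (cases p)
  have x: "x \<in> Lset" and a: "a \<in> Rset" and xa: "t x = t a"
    using p unfolding pa Tset_Lset_Rset_iff by auto
  have xS: "x \<in> S" and aS: "a \<in> S" using x a Lset_subset Rset_subset by auto
  let ?u = "t x" and ?z = "m x (m (t x) a)"
  have u: "?u \<in> S0" using xS by simp
  have au0: "m a ?u = m (t ?u) ?u" using a xa unfolding Rset_def by simp
  have au: "m a (m ?u w) = m (t ?u) (m ?u w)" if "w \<in> S" for w
    using Rset_mult_tinv[OF a that] xa by simp
  have "t ?z = ?u"
  proof (rule tinv_eqI)
    show "m ?z (m ?u ?z) = ?z" using xS aS u by (simp add: au)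
    show "m ?u (m ?z ?u) = ?u" using xS aS u by (simp add: au0)
  qed (use xS aS u in auto)
  moreover have "m ?z (m ?u (t ?u)) = x"
    using xS aS u Lset_mult_tinv_tinv[OF x] by (simp add: au)
  moreover have "m (t ?u) (m ?u ?z) = a"
  proof -
    have "m (t ?u) (m ?u a) = a" using Rset_tinv_tinv_mult[OF a] xa by simp
    thus ?thesis using xS aS by simp
  qed
  ultimately show ?thesis unfolding pa to_S_def to_T_def using xS aS by simp
qed

lemma Tset_Lset_Rset_isomorphic: "semigrp_isomorphic (Tset S0 Lset m Rset m) (Tmult S0 m m m) S m"
  unfolding semigrp_isomorphic_def semigrp_iso_def
proof (intro exI conjI)
  show "bij_betw to_S (Tset S0 Lset m Rset m) S"
  proof (rule bij_betw_byWitness[where f' = to_T])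
    show "to_S ` Tset S0 Lset m Rset m \<subseteq> S"
      using Lset_subset Rset_subset by (force simp: to_S_def Tset_def)
  qed (use to_T_to_S to_S_to_T to_T_in_Tset in blast)+
  show "\<forall>p\<in>Tset S0 Lset m Rset m. \<forall>q\<in>Tset S0 Lset m Rset m.
      to_S (Tmult S0 m m m p q) = m (to_S p) (to_S q)" using to_S_hom by blast
qed

end

theorem theorem4p4:
  fixes S0 L R :: "'a set" and mL mR star :: "'a \<Rightarrow> 'a \<Rightarrow> 'a"
  assumes "construction_data S0 L mL R mR star"
  shows "(regular_semigrp (Tset S0 L mL R mR) (Tmult S0 mL mR star) \<and>
    (\<exists>T0. inverse_transversal (Tset S0 L mL R mR) (Tmult S0 mL mR star) T0 \<and>
          multiplicative (Tset S0 L mL R mR) (Tmult S0 mL mR star) T0 \<and>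
          semigrp_isomorphic T0 (Tmult S0 mL mR star) S0 mL)) \<and>
    (\<forall>(S :: 'b set) (m :: 'b \<Rightarrow> 'b \<Rightarrow> 'b) S'.
           regular_semigrp S m \<and> inverse_transversal S m S' \<and> multiplicative S m S' \<longrightarrow>
           (\<exists>(S0' :: 'b set) L' mL' R' mR' star'. construction_data S0' L' mL' R' mR' star' \<and>
              semigrp_isomorphic (Tset S0' L' mL' R' mR') (Tmult S0' mL' mR' star') S m))"
proof (rule conjI)
  interpret construction S0 L mL R mR star by (rule construction.intro[OF assms])
  show "regular_semigrp T tm \<and> (\<exists>T0. inverse_transversal T tm T0 \<and> multiplicative T tm T0 \<and>
      semigrp_isomorphic T0 tm S0 mL)"
    using regular_T inverse_transversal_T0 multiplicative_T0 T0_isomorphic_S0 by blast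
next
  show "\<forall>(S :: 'b set) m S'. regular_semigrp S m \<and> inverse_transversal S m S' \<and> multiplicative S m S' \<longrightarrow>
      (\<exists>(S0' :: 'b set) L' mL' R' mR' star'. construction_data S0' L' mL' R' mR' star' \<and>
         semigrp_isomorphic (Tset S0' L' mL' R' mR') (Tmult S0' mL' mR' star') S m)"
  proof (intro allI impI)
    fix S :: "'b set" and m S'
    assume "regular_semigrp S m \<and> inverse_transversal S m S' \<and> multiplicative S m S'"
    hence "mult_transversal S m S'"
      unfolding mult_transversal_def mult_transversal_axioms_def inv_transversal_def regular_semigrp_def
      by blast
    then interpret mult_transversal S m S' .
    show "\<exists>(S0' :: 'b set) L' mL' R' mR' star'. construction_data S0' L' mL' R' mR' star' \<and>
        semigrp_isomorphic (Tset S0' L' mL' R' mR') (Tmult S0' mL' mR' star') S m"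
      using construction_data_Lset_Rset Tset_Lset_Rset_isomorphic by blast
  qed
qed

end
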